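(* For each integer $n \geq 829$, put $f(n)=\left[ \left(\sum_{k=n}^{\infty}\frac{1}{k^6} \right)^{-1} \right]$, and let $n_{48}$ denote the remainder when $n$ is divided by $48$ (so $0\le n_{48}\le 47$). Then \begin{equation*} f(n)=\begin{cases} 5n^5 - \frac{25}{2} n^4 +\frac{75}{4} n^3 -\frac{125}{8} n^2 +\frac{185}{48}n - \frac{5 n_{48}}{48} - \left[\frac{35-5 n_{48}}{48}\right], & \text{if } n \text{ is even}; \\ 5n^5 - \frac{25}{2} n^4 +\frac{75}{4} n^3 -\frac{125}{8} n^2 +\frac{185}{48}n - \frac{5 n_{48}+18}{48} - \left[\frac{17-5 n_{48}}{48}\right], & \text{if } n \text{ is odd}. \end{cases} \end{equation*}
   Context: For a real number $x$, $[x]$ denotes the greatest integer less than or equal to $x$. *)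

theory Defs
  imports "HOL-Analysis.Analysis"
begin

(* The series over k >= n is written with the index shifted, k = n + j with j = 0, 1, 2, ... *)
definition zeta6_tail :: "nat \<Rightarrow> real" where
  "zeta6_tail n = (\<Sum>j. 1 / real (n + j) ^ 6)"

definition f :: "nat \<Rightarrow> int" where
  "f n = \<lfloor>inverse (zeta6_tail n)\<rfloor>"

end

(* Write Q n for the polynomial part of the formula. Then 1 / zeta6_tail n = Q n + 25/96 + e/n + ...
   with e = 1625/192, which lies in [Q n + 12/48, Q n + 13/48) for large n; 43/5 below is a value
   slightly above e that still satisfies 25/96 + (43/5)/829 < 13/48.
   Both bounds come from comparing 1/k^6 with the telescoping differences g k - g (k + 1), where
   1/g k is Q k + 1/4, respectively Q k + 25/96 + (43/5)/k. Finally 48 * Q n is an integer whose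
   residue modulo 48 is that of 5 n or 5 n + 18, which turns the enclosure into the floor formula. *)
theory Submission
  imports Defs "HOL-Real_Asymp.Real_Asymp"
begin

lemma zeta6_tail_summable: "summable (\<lambda>j. 1 / real (n + j) ^ 6)"
proof -
  have "summable (\<lambda>j. 1 / real j ^ 6)"
    using inverse_power_summable[of 6, where 'a = real] by (simp add: inverse_eq_divide)
  then show ?thesis
    using summable_ignore_initial_segment[of "\<lambda>j. 1 / real j ^ 6" n] by (simp add: add.commute)
qed

lemma telescope_shifted_sums:
  fixes g :: "nat \<Rightarrow> real"
  assumes "g \<longlonglongrightarrow> 0"
  shows "(\<lambda>j. g (n + j) - g (Suc (n + j))) sums g n"
  using telescope_sums'[of "\<lambda>j. g (n + j)" 0] LIMSEQ_ignore_initial_segment[OF assms, of n]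
  by (simp add: add.commute)

text \<open>Since \<open>g\<close> tends to 0, the differences on the right telescope to
  \<open>g n\<close>, so a termwise bound for k \<ge> n passes to the whole tail.\<close>

lemma zeta6_tail_le:
  assumes "g \<longlonglongrightarrow> 0" and "\<And>k. k \<ge> n \<Longrightarrow> 1 / real k ^ 6 \<le> g k - g (Suc k)"
  shows "zeta6_tail n \<le> g n"
  unfolding zeta6_tail_def
  by (rule sums_le[OF _ summable_sums[OF zeta6_tail_summable] telescope_shifted_sums[OF assms(1)]])
    (simp add: assms(2) flip: of_nat_add)

lemma zeta6_tail_ge:
  assumes "g \<longlonglongrightarrow> 0" and "\<And>k. k \<ge> n \<Longrightarrow> g k - g (Suc k) \<le> 1 / real k ^ 6"
  shows "g n \<le> zeta6_tail n"
  unfolding zeta6_tail_def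
  by (rule sums_le[OF _ telescope_shifted_sums[OF assms(1)] summable_sums[OF zeta6_tail_summable]])
    (simp add: assms(2) flip: of_nat_add)

definition Q :: "real \<Rightarrow> real" where
  "Q x = 5 * x ^ 5 - 25 / 2 * x ^ 4 + 75 / 4 * x ^ 3 - 125 / 8 * x ^ 2 + 185 / 48 * x"

lemma Q_nonneg:
  assumes "x \<ge> 2"
  shows "Q x \<ge> 0"
proof -
  \<comment> \<open>Taylor expansion at 2, where every coefficient is positive.\<close>
  have "Q x = 5 * (x - 2) ^ 5 + 75 / 2 * (x - 2) ^ 4 + 475 / 4 * (x - 2) ^ 3 + 1575 / 8 * (x - 2) ^ 2
      + 7985 / 48 * (x - 2) + 1325 / 24"
    unfolding Q_def by algebra
  then show ?thesis using assms by simp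
qed

text \<open>With \<open>c\<close> = k^6 this clears denominators, turning each telescoping
  comparison into a polynomial or rational inequality.\<close>

lemma inverse_diff_le_iff:
  fixes a b c :: real
  assumes "a > 0" "b > 0" "c > 0"
  shows "inverse a - inverse b \<le> 1 / c \<longleftrightarrow> c * (b - a) \<le> a * b"
    and "1 / c \<le> inverse a - inverse b \<longleftrightarrow> a * b \<le> c * (b - a)"
  using assms by (simp_all add: field_simps)

text \<open>The terms of degree 6 to 10 cancel in the difference of the two sides. The coefficient
  of x^5 that remains is 10 * (25/96 - 1/4) > 0, and the only negative coefficient, at x^2, is
  absorbed by the one at x^4.\<close>

lemma lower_step:
  fixes x :: real
  assumes "x \<ge> 1"
  shows "(Q x + 1 / 4) * (Q (x + 1) + 1 / 4) \<le> x ^ 6 * (Q (x + 1) - Q x)"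
proof -
  have "x ^ 6 * (Q (x + 1) - Q x) - (Q x + 1 / 4) * (Q (x + 1) + 1 / 4)
      = 5 / 48 * x ^ 5 + 17875 / 192 * x ^ 4 + 25 / 64 * x ^ 3 - 52975 / 2304 * x ^ 2
        + 185 / 2304 * x + 13 / 192"
    unfolding Q_def by algebra
  moreover have "x ^ 2 \<le> x ^ 4"
    using assms by (intro power_increasing) auto
  moreover have "x ^ 3 \<ge> 0" "x ^ 4 \<ge> 0" "x ^ 5 \<ge> 0"
    using assms by simp_all
  ultimately show ?thesis
    using assms by linarith
qed

text \<open>The constant 25/96 cancels one order more than 1/4 does, so the sign is decided by the
  1/x term: the leading coefficient becomes 11 * (43/5 - 1625/192) = 1441/960 > 0.\<close>

lemma upper_step:
  fixes x :: real
  assumes "x \<ge> 34"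
  defines "U \<equiv> \<lambda>x. Q x + 25 / 96 + 43 / 5 / x"
  shows "x ^ 6 * (U (x + 1) - U x) \<le> U x * U (x + 1)"
proof -
  \<comment> \<open>\<open>N x\<close> is x * \<open>U x\<close>, a polynomial, so that the identity
    below is free of division.\<close>
  define N where "N x = x * (Q x + 25 / 96) + 43 / 5" for x
  have "N x * N (x + 1) - x ^ 6 * (x * N (x + 1) - (x + 1) * N x)
      = 1441 / 960 * x ^ 6 - 9619 / 192 * x ^ 5 + 1043695 / 2304 * x ^ 4 + 424495 / 2304 * x ^ 3
        + 1848719 / 9216 * x ^ 2 + 304847 / 9216 * x + 172129 / 2400"
    unfolding Q_def N_def by algebra
  \<comment> \<open>The only negative coefficient is that of x^5. Its ratio to the leading one is
    about 33.4 in absolute value, hence the threshold 34.\<close>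
  moreover have "34 * x ^ 5 \<le> x ^ 6"
    using mult_right_mono[OF assms(1), of "x ^ 5"] assms(1) by (simp add: eval_nat_numeral)
  moreover have "x ^ 2 \<ge> 0" "x ^ 3 \<ge> 0" "x ^ 4 \<ge> 0" "x ^ 5 \<ge> 0"
    using assms by simp_all
  ultimately have "x ^ 6 * (x * N (x + 1) - (x + 1) * N x) \<le> N x * N (x + 1)"
    using assms(1) by linarith
  then have "x ^ 6 * (x * N (x + 1) - (x + 1) * N x) / (x * (x + 1))
      \<le> N x * N (x + 1) / (x * (x + 1))"
    using assms(1) by (intro divide_right_mono) auto
  moreover have "U x = N x / x" "U (x + 1) = N (x + 1) / (x + 1)"
    using assms(1) by (simp_all add: U_def N_def field_simps)
  ultimately show ?thesis
    using assms(1) by (simp add: diff_divide_distrib right_diff_distrib)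
qed

lemma inverse_zeta6_tail_ge:
  assumes "n \<ge> 2"
  shows "Q (real n) + 1 / 4 \<le> inverse (zeta6_tail n)"
proof -
  have lim: "(\<lambda>k. inverse (Q (real k) + 1 / 4)) \<longlonglongrightarrow> 0"
    unfolding Q_def by real_asymp
  have le: "zeta6_tail n \<le> inverse (Q (real n) + 1 / 4)"
  proof (rule zeta6_tail_le[OF lim])
    fix k assume "k \<ge> n"
    with assms have k: "real k \<ge> 2" by simp
    show "1 / real k ^ 6 \<le> inverse (Q (real k) + 1 / 4) - inverse (Q (real (Suc k)) + 1 / 4)"
      using lower_step[of "real k"] k Q_nonneg[of "real k"] Q_nonneg[of "real k + 1"]
      by (subst inverse_diff_le_iff) (simp_all add: add.commute)
  qed
  have "zeta6_tail n > 0"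
    unfolding zeta6_tail_def using assms by (intro suminf_pos zeta6_tail_summable) auto
  with le_imp_inverse_le[OF le] show ?thesis by simp
qed

lemma inverse_zeta6_tail_le:
  assumes "n \<ge> 34"
  shows "inverse (zeta6_tail n) \<le> Q (real n) + 25 / 96 + 43 / 5 / real n"
proof -
  define U where "U x = Q x + 25 / 96 + 43 / 5 / x" for x
  have pos: "U x > 0" if "x \<ge> 2" for x
    using Q_nonneg[OF that] that by (simp add: U_def add_nonneg_pos add_pos_nonneg)
  have lim: "(\<lambda>k. inverse (U (real k))) \<longlonglongrightarrow> 0"
    unfolding U_def Q_def by real_asymp
  have le: "inverse (U (real n)) \<le> zeta6_tail n"
  proof (rule zeta6_tail_ge[OF lim])
    fix k assume "k \<ge> n"
    with assms have k: "real k \<ge> 34" by simp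
    show "inverse (U (real k)) - inverse (U (real (Suc k))) \<le> 1 / real k ^ 6"
      using upper_step[of "real k"] k pos[of "real k"] pos[of "real k + 1"]
      by (subst inverse_diff_le_iff) (simp_all add: U_def add.commute)
  qed
  have "inverse (U (real n)) > 0"
    using pos[of "real n"] assms by simp
  from le_imp_inverse_le[OF le this] show ?thesis by (simp add: U_def)
qed

text \<open>For even n the integer 48 * Q n is congruent to 5 n modulo 48, and n may be replaced
  there by its remainder.\<close>

lemma Q_residue_even:
  assumes "even n"
  obtains t :: int where "Q (real n) = of_int t + 5 * real (n mod 48) / 48"
proof -
  define q where "q = int (n div 48)"
  obtain m where m: "n = 2 * m" using assms by blast
  \<comment> \<open>Modulo 2 this is m^2 - m. The extra factor 2 raises the coefficient 24 in the
    expansion of 48 * Q n to 48; the higher coefficients 7680, 9600 and 7200 are already multiples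
    of 48.\<close>
  have "even (125 * int m ^ 2 - 15 * int m)" by simp
  then obtain j where "125 * int m ^ 2 - 15 * int m = 2 * j" by blast
  then have j: "125 * real m ^ 2 - 15 * real m = 2 * of_int j"
    by (metis (mono_tags) of_int_diff of_int_mult of_int_numeral of_int_of_nat_eq of_int_power)
  have "real n = 2 * real m"
    using m by simp
  moreover have "real (n div 48) * 48 + real (n mod 48) = real n"
    using arg_cong[OF div_mult_mod_eq[of n 48], of real]
    by (simp only: of_nat_add of_nat_mult of_nat_numeral)
  ultimately have n: "real n = 2 * real m" "real (n mod 48) = 2 * real m - 48 * of_int q"
    by (simp_all add: q_def)
  have "48 * Q (2 * real m) = 5 * (2 * real m) + 7680 * real m ^ 5 - 9600 * real m ^ 4
      + 7200 * real m ^ 3 - 24 * (125 * real m ^ 2 - 15 * real m)"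
    unfolding Q_def by algebra
  then have "Q (real n) = 160 * real m ^ 5 - 200 * real m ^ 4 + 150 * real m ^ 3 - of_int j
      + 5 * of_int q + 5 * real (n mod 48) / 48"
    unfolding n j by (simp add: diff_divide_distrib add_divide_distrib)
  then show thesis
    by (intro that[of "160 * int m ^ 5 - 200 * int m ^ 4 + 150 * int m ^ 3 - j + 5 * q"]) simp
qed

lemma Q_residue_odd:
  assumes "odd n"
  obtains t :: int where "Q (real n) = of_int t + (5 * real (n mod 48) + 18) / 48"
proof -
  define q where "q = int (n div 48)"
  obtain m where m: "n = 2 * m + 1" using assms by (elim oddE)
  have "even (125 * int m ^ 2 + 15 * int m)" by simp
  then obtain j where "125 * int m ^ 2 + 15 * int m = 2 * j" by blast
  then have j: "125 * real m ^ 2 + 15 * real m = 2 * of_int j"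
    by (metis (mono_tags) of_int_add of_int_mult of_int_numeral of_int_of_nat_eq of_int_power)
  have "real n = 2 * real m + 1"
    using m by simp
  moreover have "real (n div 48) * 48 + real (n mod 48) = real n"
    using arg_cong[OF div_mult_mod_eq[of n 48], of real]
    by (simp only: of_nat_add of_nat_mult of_nat_numeral)
  ultimately have n: "real n = 2 * real m + 1" "real (n mod 48) = 2 * real m + 1 - 48 * of_int q"
    by (simp_all add: q_def)
  \<comment> \<open>Here -30 = 18 - 48 produces both the shift 18 in the residue and the summand -1
    in the integer part.\<close>
  have "48 * Q (2 * real m + 1) = 5 * (2 * real m + 1) + 7680 * real m ^ 5 + 9600 * real m ^ 4
      + 7200 * real m ^ 3 + 24 * (125 * real m ^ 2 + 15 * real m) - 30"
    unfolding Q_def by algebra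
  then have "Q (real n) = 160 * real m ^ 5 + 200 * real m ^ 4 + 150 * real m ^ 3 + of_int j
      - 1 + 5 * of_int q + (5 * real (n mod 48) + 18) / 48"
    unfolding n j by (simp add: diff_divide_distrib add_divide_distrib)
  then show thesis
    by (intro that[of "160 * int m ^ 5 + 200 * int m ^ 4 + 150 * int m ^ 3 + j - 1 + 5 * q"]) simp
qed

text \<open>The interval has length 1/48 and starts at a multiple of 1/48, so the floor of y is t
  plus that of (r + 12)/48. The latter equals minus the floor of (35 - r)/48, because 12 + 35 =
  47.\<close>

lemma floor_of_enclosure:
  fixes t r :: int and y :: real
  assumes "of_int t + (of_int r + 12) / 48 \<le> y" and "y < of_int t + (of_int r + 13) / 48"
  shows "\<lfloor>y\<rfloor> = t - \<lfloor>(35 - of_int r :: real) / 48\<rfloor>"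
proof -
  define z where "z = \<lfloor>(35 - of_int r :: real) / 48\<rfloor>"
  have "of_int z \<le> (35 - of_int r :: real) / 48" "(35 - of_int r :: real) / 48 < of_int z + 1"
    unfolding z_def by linarith+
  then have "(of_int (48 * z) :: real) \<le> of_int (35 - r)"
    "(of_int (35 - r) :: real) < of_int (48 * z + 48)"
    by simp_all
  \<comment> \<open>Over the integers, < 48 z + 48 sharpens to \<le> 48 z + 47; this unit makes room
    for the 13 in the upper bound.\<close>
  then have "48 * z \<le> 35 - r" "35 - r \<le> 48 * z + 47"
    unfolding of_int_le_iff of_int_less_iff by simp_all
  then have "(of_int (48 * z) :: real) \<le> of_int (35 - r)"
    "(of_int (35 - r) :: real) \<le> of_int (48 * z + 47)"
    unfolding of_int_le_iff by simp_all
  then have "of_int (t - z) \<le> y" "y < of_int (t - z) + 1"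
    using assms unfolding of_int_diff of_int_add of_int_mult of_int_numeral by argo+
  then show ?thesis
    unfolding z_def[symmetric] by linarith
qed

theorem theorem2p1:
  fixes n :: nat
  assumes "n \<ge> 829"
  shows "real_of_int (f n) =
    (if even n then
       5 * real n ^ 5 - 25 / 2 * real n ^ 4 + 75 / 4 * real n ^ 3 - 125 / 8 * real n ^ 2
         + 185 / 48 * real n - 5 * real (n mod 48) / 48
         - real_of_int \<lfloor>(35 - 5 * real (n mod 48)) / 48\<rfloor>
     else
       5 * real n ^ 5 - 25 / 2 * real n ^ 4 + 75 / 4 * real n ^ 3 - 125 / 8 * real n ^ 2
         + 185 / 48 * real n - (5 * real (n mod 48) + 18) / 48
         - real_of_int \<lfloor>(17 - 5 * real (n mod 48)) / 48\<rfloor>)"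
proof -
  have "43 / 5 / real n \<le> 43 / 5 / 829"
    using assms by (intro divide_left_mono) auto
  then have hi: "inverse (zeta6_tail n) < Q (real n) + 13 / 48"
    using inverse_zeta6_tail_le[of n] assms by simp
  have lo: "Q (real n) + 12 / 48 \<le> inverse (zeta6_tail n)"
    using inverse_zeta6_tail_ge[of n] assms by simp
  show ?thesis
  proof (cases "even n")
    case True
    then obtain t :: int where t: "Q (real n) = of_int t + 5 * real (n mod 48) / 48"
      by (rule Q_residue_even)
    have "f n = t - \<lfloor>(35 - of_int (5 * int (n mod 48)) :: real) / 48\<rfloor>"
      unfolding f_def by (rule floor_of_enclosure) (use lo hi t in \<open>simp_all add: add_divide_distrib\<close>)
    then show ?thesis
      using True t by (simp add: Q_def)
  next
    case False
    then obtain t :: int where t: "Q (real n) = of_int t + (5 * real (n mod 48) + 18) / 48"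
      by (rule Q_residue_odd)
    \<comment> \<open>With r = 5 * (n mod 48) + 18, the numerator 35 - r is the 17 - 5 * (n mod 48)
      of the odd case.\<close>
    have "f n = t - \<lfloor>(35 - of_int (5 * int (n mod 48) + 18) :: real) / 48\<rfloor>"
      unfolding f_def by (rule floor_of_enclosure) (use lo hi t in \<open>simp_all add: add_divide_distrib\<close>)
    then show ?thesis
      using False t by (simp add: Q_def)
  qed
qed

end
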